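(* Let $X_1, X_2, \ldots$ be independent and identically distributed real-valued random variables satisfying $\mathbf{E}[X_1] = 0$ and $\mathbf{E}[X_1^2] = 1$. Then $$\frac{X_1+\cdots+X_n}{\sqrt{n}} \Rightarrow Z,$$ where $Z$ is a standard normal random variable.
   Context: A standard normal random variable $Z$ is one satisfying $\mathbf{P}(Z \le x) = \int_{-\infty}^x \frac{e^{-t^2/2}}{\sqrt{2\pi}}\,dt$ for all $x \in \mathbf{R}$. For random variables $S_1, S_2, \ldots$ and a normal random variable $W$, the notation $S_n \Rightarrow W$ (convergence in distribution) means $\lim_{n\to\infty} \mathbf{P}(S_n \le x) = \mathbf{P}(W \le x)$ for all $x \in \mathbf{R}$. *)

theory Defs
  imports "HOL-Probability.Probability"
begin

definition std_normal_rv :: "'a measure \<Rightarrow> ('a \<Rightarrow> real) \<Rightarrow> bool" where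
  "std_normal_rv M Z \<longleftrightarrow>
     prob_space M \<and> Z \<in> borel_measurable M \<and>
     (\<forall>x. \<P>(\<omega> in M. Z \<omega> \<le> x) = (LBINT t:{..x}. exp (- t\<^sup>2 / 2) / sqrt (2 * pi)))"

text \<open>
  Convergence in distribution to a normal random variable \<open>W\<close>: pointwise convergence of the
  distribution functions at every real point. It is only meant for \<open>W\<close> with a continuous
  distribution function; in general only the continuity points would be considered.
  The limit \<open>W\<close> may live on a different probability space.
\<close>

definition conv_in_distr_normal ::
    "'a measure \<Rightarrow> (nat \<Rightarrow> 'a \<Rightarrow> real) \<Rightarrow> 'b measure \<Rightarrow> ('b \<Rightarrow> real) \<Rightarrow> bool" where
  "conv_in_distr_normal M S N W \<longleftrightarrow>
     (\<forall>x. (\<lambda>n. \<P>(\<omega> in M. S n \<omega> \<le> x)) \<longlonglongrightarrow> \<P>(\<omega> in N. W \<omega> \<le> x))"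

end

theory Submission
  imports Defs
begin

text \<open>
  By independence, the characteristic function of the normalised sum at \<open>t\<close> is the \<open>n\<close>-th power
  of that of \<open>X 1\<close> at \<open>t / sqrt n\<close>. Mean 0 and variance 1 make the latter
  \<open>1 - t\<^sup>2 / (2 * n)\<close> up to an error of order \<open>o(1 / n)\<close>, so the powers tend to
  \<open>exp (- t\<^sup>2 / 2)\<close>, the characteristic function of the standard normal law, and Levy's
  continuity theorem turns this into weak convergence. This argument is
  \<open>central_limit_theorem_zero_mean\<close>; its variables are indexed from 0, so it is applied to the
  shifted sequence \<open>X (Suc i)\<close>, which is again independent (\<open>indep_vars_reindex\<close>).

  Weak convergence gives convergence of the distribution functions only where the limit is
  continuous. The normal law has a Lebesgue density, hence no atoms, so that is everywhere
  (\<open>isCont_cdf_std_normal\<close>). Finally, its distribution function is the Gaussian integral by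
  which \<open>Z\<close> is characterised (\<open>cdf_std_normal_eq_integral\<close>).
\<close>

lemma isCont_cdf_std_normal: "isCont (cdf std_normal_distribution) x"
proof -
  interpret real_distribution std_normal_distribution
    by (rule real_dist_normal_dist)
  have "AE t in lborel. t \<in> {x} \<longrightarrow> ennreal (std_normal_density t) = 0"
    using AE_lborel_singleton[of x] by eventually_elim simp
  then have "{x} \<in> null_sets std_normal_distribution"
    by (subst null_sets_density_iff) auto
  then show ?thesis
    unfolding isCont_cdf by (simp add: measure_eq_0_null_sets)
qed

lemma cdf_std_normal_eq_integral:
  "cdf std_normal_distribution x = (LBINT t:{..x}. exp (- t\<^sup>2 / 2) / sqrt (2 * pi))"
proof -
  have "cdf std_normal_distribution x = (LINT t|std_normal_distribution. indicator {..x} t)"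
    unfolding cdf_def2 by simp
  also have "\<dots> = (LINT t|lborel. std_normal_density t *\<^sub>R indicator {..x} t)"
    by (rule integral_density) simp_all
  finally show ?thesis
    by (simp add: set_lebesgue_integral_def std_normal_density_def mult.commute)
qed

text \<open>
  A finite subfamily of the reindexed family is, by injectivity, a finite subfamily of the
  original one, so the product formula carries over.
\<close>

lemma (in prob_space) indep_sets_reindex:
  assumes "indep_sets F (f ` I)" and inj: "inj_on f I"
  shows "indep_sets (\<lambda>i. F (f i)) I"
proof (rule indep_setsI)
  show "F (f i) \<subseteq> events" if "i \<in> I" for i
    using assms(1) that unfolding indep_sets_def by auto
next
  fix A J
  assume J: "J \<noteq> {}" "J \<subseteq> I" "finite J" and A: "\<forall>j\<in>J. A j \<in> F (f j)"
  have injJ: "inj_on f J"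
    using inj J(2) by (rule inj_on_subset)
  let ?B = "\<lambda>k. A (the_inv_into J f k)"
  have B: "?B (f j) = A j" if "j \<in> J" for j
    using the_inv_into_f_f[OF injJ that] by simp
  have "prob (\<Inter>k\<in>f ` J. ?B k) = (\<Prod>k\<in>f ` J. prob (?B k))"
    using J A B by (intro indep_setsD[OF assms(1)]) auto
  then show "prob (\<Inter>j\<in>J. A j) = (\<Prod>j\<in>J. prob (A j))"
    by (simp add: prod.reindex[OF injJ] B cong: INF_cong_simp prod.cong_simp)
qed

lemma (in prob_space) indep_vars_reindex:
  assumes "indep_vars N X (f ` I)" and "inj_on f I"
  shows "indep_vars (\<lambda>i. N (f i)) (\<lambda>i. X (f i)) I"
  using assms indep_sets_reindex[OF _ assms(2)]
  unfolding indep_vars_def2 by blast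

theorem theorem2:
  fixes M :: "'a measure" and X :: "nat \<Rightarrow> 'a \<Rightarrow> real"
    and N :: "'b measure" and Z :: "'b \<Rightarrow> real"
  assumes "prob_space M"
    and "prob_space.indep_vars M (\<lambda>_. borel) X {1..}"
    and "\<And>i. i \<ge> 1 \<Longrightarrow> distr M borel (X i) = distr M borel (X 1)"
    and "integrable M (X 1)" and "(LINT \<omega>|M. X 1 \<omega>) = 0"
    and "integrable M (\<lambda>\<omega>. (X 1 \<omega>)\<^sup>2)" and "(LINT \<omega>|M. (X 1 \<omega>)\<^sup>2) = 1"
    and "std_normal_rv N Z"
  shows "conv_in_distr_normal M (\<lambda>n \<omega>. (\<Sum>i=1..n. X i \<omega>) / sqrt (real n)) N Z"
proof -
  interpret prob_space M by fact
  let ?S = "\<lambda>n \<omega>. (\<Sum>i=1..n. X i \<omega>) / sqrt (real n)"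
  have rv [measurable]: "X i \<in> borel_measurable M" if "i \<ge> 1" for i
    using assms(2) that unfolding indep_vars_def by auto
  have S_rv [measurable]: "?S n \<in> borel_measurable M" for n
    by (intro borel_measurable_divide borel_measurable_sum) (auto intro: rv)
  have indep: "indep_vars (\<lambda>_. borel) (\<lambda>i. X (Suc i)) UNIV"
    by (rule indep_vars_reindex[OF indep_vars_subset[OF assms(2)]]) auto
  have law: "distr M borel (X (Suc i)) = distr M borel (X 1)" for i
    using assms(3)[of "Suc i"] by simp
  \<comment> \<open>Moments depend on the law only, so those of \<open>X 1\<close> are those of every variable.\<close>
  have sq_int: "integrable M (\<lambda>\<omega>. (X (Suc i) \<omega>)\<^sup>2)" for i
    using assms(6) integrable_distr_eq[OF rv[of "Suc i"], of "\<lambda>x. x\<^sup>2"]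
      integrable_distr_eq[OF rv[of 1], of "\<lambda>x. x\<^sup>2"] law[of i] by simp
  have mean: "expectation (X (Suc i)) = 0" for i
    using assms(5) integral_distr[OF rv[of "Suc i"], of "\<lambda>x. x"]
      integral_distr[OF rv[of 1], of "\<lambda>x. x"] law[of i] by simp
  have second_moment: "expectation (\<lambda>\<omega>. (X (Suc i) \<omega>)\<^sup>2) = 1" for i
    using assms(7) integral_distr[OF rv[of "Suc i"], of "\<lambda>x. x\<^sup>2"]
      integral_distr[OF rv[of 1], of "\<lambda>x. x\<^sup>2"] law[of i] by simp
  have "weak_conv_m (\<lambda>n. distr M borel (\<lambda>\<omega>. (\<Sum>i<n. X (Suc i) \<omega>) / sqrt (real n * 1\<^sup>2)))
          std_normal_distribution"
    by (rule central_limit_theorem_zero_mean[OF indep mean _ sq_int _ law])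
       (simp_all add: mean second_moment del: One_nat_def)
  then have "weak_conv_m (\<lambda>n. distr M borel (?S n)) std_normal_distribution"
    by (simp add: sum.atLeast1_atMost_eq)
  then have "(\<lambda>n. cdf (distr M borel (?S n)) x) \<longlonglongrightarrow> cdf std_normal_distribution x" for x
    unfolding weak_conv_m_def weak_conv_def using isCont_cdf_std_normal by blast
  moreover have "cdf (distr M borel (?S n)) x = \<P>(\<omega> in M. ?S n \<omega> \<le> x)" for n x
    unfolding cdf_def2 by (subst measure_distr[OF S_rv]) (auto intro!: arg_cong[where f = prob])
  moreover have "\<P>(\<omega> in N. Z \<omega> \<le> x) = cdf std_normal_distribution x" for x
    using assms(8) unfolding std_normal_rv_def cdf_std_normal_eq_integral by blast
  ultimately show ?thesis
    unfolding conv_in_distr_normal_def by simp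
qed

end
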